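(* Let $F=\langle W,R\rangle$ be a transitive Kripke frame. Then $F$ is of locally finite height if and only if the rule $(\Diamond^{*})$ is strongly valid in $F$.
   Context: Modal formulas are built from a countable set $\mathsf{Prop}$ of propositional variables and $\top,\bot$ using $\land$, $\neg$ and $\Box$; $\lor$ and $\supset$ are defined in the usual way, $\Diamond\phi$ abbreviates $\neg\Box\neg\phi$, and $\Diamond^{n}$ is the $n$-fold application of $\Diamond$. A Kripke frame is a pair $F=\langle W,R\rangle$ with $W$ a non-empty set and $R$ a binary relation on $W$; it is transitive if $R$ is transitive. A valuation on $F$ is a map $v:\mathsf{Prop}\to\mathcal{P}(W)$, extended to all formulas by $v(\top)=W$, $v(\bot)=\emptyset$, $v(\phi\land\psi)=v(\phi)\cap v(\psi)$, $v(\neg\phi)=W\setminus v(\phi)$, $v(\Box\phi)=\{w\in W\mid \forall w'\in W\,((w,w')\in R\Rightarrow w'\in v(\phi))\}$. For $w\in W$, the height from $w$ is finite if the supremum of the lengths of lists $w=w_0,w_1,\ldots,w_n\in W$ with $(w_i,w_{i+1})\in R$ for all $i<n$ is finite. $F$ is of locally finite height if for every $w\in W$ the height from $w$ is finite. An inference rule is a pair $(\Gamma,\phi)$ of a (possibly infinite) set $\Gamma$ of formulas and a formula $\phi$. It is strongly valid in $F$ if for every valuation $v$ on $F$, $\bigcap_{\gamma\in\Gamma}v(\gamma)\subseteq v(\phi)$. The rule $(\Diamond^{*})$ is the scheme consisting of all pairs $(\{\phi\supset\Diamond^{n}\top\mid n\in\omega\},\ \phi\supset\bot)$, where $\phi$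 ranges over all formulas; it is strongly valid in $F$ if all these pairs are strongly valid in $F$. *)

theory Defs
  imports "HOL-Library.Extended_Nat"
begin

datatype 'p fm =
    Var 'p
  | Top
  | Bot
  | And "'p fm" "'p fm"
  | Neg "'p fm"
  | Box "'p fm"

definition Or :: "'p fm \<Rightarrow> 'p fm \<Rightarrow> 'p fm" where
  "Or \<phi> \<psi> = Neg (And (Neg \<phi>) (Neg \<psi>))"

definition Imp :: "'p fm \<Rightarrow> 'p fm \<Rightarrow> 'p fm" where
  "Imp \<phi> \<psi> = Or (Neg \<phi>) \<psi>"

definition Dia :: "'p fm \<Rightarrow> 'p fm" where
  "Dia \<phi> = Neg (Box (Neg \<phi>))"

definition kripke_frame :: "'w set \<Rightarrow> ('w \<times> 'w) set \<Rightarrow> bool" where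
  "kripke_frame W R \<longleftrightarrow> W \<noteq> {} \<and> R \<subseteq> W \<times> W"

definition valuation :: "'w set \<Rightarrow> ('p \<Rightarrow> 'w set) \<Rightarrow> bool" where
  "valuation W v \<longleftrightarrow> (\<forall>p. v p \<subseteq> W)"

primrec ext :: "'w set \<Rightarrow> ('w \<times> 'w) set \<Rightarrow> ('p \<Rightarrow> 'w set) \<Rightarrow> 'p fm \<Rightarrow> 'w set" where
  "ext W R v (Var p) = v p"
| "ext W R v Top = W"
| "ext W R v Bot = {}"
| "ext W R v (And \<phi> \<psi>) = ext W R v \<phi> \<inter> ext W R v \<psi>"
| "ext W R v (Neg \<phi>) = W - ext W R v \<phi>"
| "ext W R v (Box \<phi>) = {w \<in> W. \<forall>w' \<in> W. (w, w') \<in> R \<longrightarrow> w' \<in> ext W R v \<phi>}"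

definition chains_from :: "'w set \<Rightarrow> ('w \<times> 'w) set \<Rightarrow> 'w \<Rightarrow> 'w list set" where
  "chains_from W R w =
     {ws. ws \<noteq> [] \<and> hd ws = w \<and> set ws \<subseteq> W \<and>
          (\<forall>i. Suc i < length ws \<longrightarrow> (ws ! i, ws ! Suc i) \<in> R)}"

(* A list w_0, ..., w_n has length n + 1 here; only finiteness of the height matters below,
   and that is the same if steps are counted instead of worlds. *)
definition height_from :: "'w set \<Rightarrow> ('w \<times> 'w) set \<Rightarrow> 'w \<Rightarrow> enat" where
  "height_from W R w = (SUP ws \<in> chains_from W R w. enat (length ws))"

definition locally_finite_height :: "'w set \<Rightarrow> ('w \<times> 'w) set \<Rightarrow> bool" where
  "locally_finite_height W R \<longleftrightarrow> (\<forall>w \<in> W. height_from W R w < \<infinity>)"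

type_synonym 'p rule = "'p fm set \<times> 'p fm"

(* The intersection is taken within W, so that for an empty premise set it is W and not UNIV. *)
definition strongly_valid :: "'w set \<Rightarrow> ('w \<times> 'w) set \<Rightarrow> 'p rule \<Rightarrow> bool" where
  "strongly_valid W R r \<longleftrightarrow>
     (\<forall>v. valuation W v \<longrightarrow> W \<inter> (\<Inter>\<gamma> \<in> fst r. ext W R v \<gamma>) \<subseteq> ext W R v (snd r))"

definition scheme_strongly_valid :: "'w set \<Rightarrow> ('w \<times> 'w) set \<Rightarrow> 'p rule set \<Rightarrow> bool" where
  "scheme_strongly_valid W R S \<longleftrightarrow> (\<forall>r \<in> S. strongly_valid W R r)"

definition diamond_star :: "'p rule set" where
  "diamond_star = {({Imp \<phi> ((Dia ^^ n) Top) | n. True}, Imp \<phi> Bot) | \<phi>. True}"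

end

theory Submission
  imports Defs
begin

text \<open>
  A world satisfies \<open>\<Diamond>\<^sup>n\<top>\<close> exactly if a chain with \<open>n\<close> steps starts there
  (\<open>mem_ext_Dia_pow_iff\<close>). As chains are closed under non-empty prefixes, the height from a
  world is infinite exactly if chains of every length start there (\<open>height_from_infinite_iff\<close>),
  hence exactly if the world satisfies \<open>\<Diamond>\<^sup>n\<top>\<close> for all \<open>n\<close>.

  An instance of the rule \<open>(\<Diamond>\<^sup>*)\<close> fails exactly if some valuation and some world make \<open>\<phi>\<close> and
  all \<open>\<Diamond>\<^sup>n\<top>\<close> true. So a failing instance yields a world of infinite height, whatever \<open>\<phi>\<close> is;
  and at a world of infinite height the instance \<open>\<phi> = \<top>\<close> fails under every valuation, because
  no variable occurs in it.
\<close>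

lemma mem_ext_Imp:
  "w \<in> ext W R v (Imp \<phi> \<psi>) \<longleftrightarrow> w \<in> W \<and> (w \<in> ext W R v \<phi> \<longrightarrow> w \<in> ext W R v \<psi>)"
  by (auto simp: Imp_def Or_def)

lemma ext_Dia: "ext W R v (Dia \<phi>) = {w \<in> W. \<exists>w' \<in> W. (w, w') \<in> R \<and> w' \<in> ext W R v \<phi>}"
  by (auto simp: Dia_def)

lemma chains_from_eq_successively:
  "chains_from W R w =
     {ws. ws \<noteq> [] \<and> hd ws = w \<and> set ws \<subseteq> W \<and> successively (\<lambda>x y. (x, y) \<in> R) ws}"
  by (simp add: chains_from_def successively_conv_nth)

lemma chains_from_Cons:
  "x # ws \<in> chains_from W R w \<longleftrightarrow>
     x = w \<and> w \<in> W \<and> (ws = [] \<or> (w, hd ws) \<in> R \<and> ws \<in> chains_from W R (hd ws))"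
  by (cases ws) (auto simp: chains_from_eq_successively)

lemma take_in_chains_from:
  "ws \<in> chains_from W R w \<Longrightarrow> n > 0 \<Longrightarrow> take n ws \<in> chains_from W R w"
  by (auto simp: chains_from_def hd_take dest: in_set_takeD)

lemma mem_ext_Dia_pow_iff:
  "w \<in> ext W R v ((Dia ^^ n) Top) \<longleftrightarrow> (\<exists>ws \<in> chains_from W R w. length ws = Suc n)"
proof (induction n arbitrary: w)
  case 0
  show ?case
    by (auto simp: length_Suc_conv chains_from_Cons)
next
  case (Suc n)
  have "w \<in> ext W R v ((Dia ^^ Suc n) Top) \<longleftrightarrow>
        w \<in> W \<and> (\<exists>w' \<in> W. (w, w') \<in> R \<and> (\<exists>ws \<in> chains_from W R w'. length ws = Suc n))"
    by (simp add: ext_Dia Suc.IH)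
  also have "\<dots> \<longleftrightarrow> (\<exists>ws. w # ws \<in> chains_from W R w \<and> length ws = Suc n)"
  proof -
    have "w' = hd ws \<and> w' \<in> W \<and> ws \<noteq> []" if "ws \<in> chains_from W R w'" for w' ws
      using that by (auto simp: chains_from_def)
    then show ?thesis
      unfolding chains_from_Cons by (metis length_0_conv nat.distinct(1))
  qed
  also have "\<dots> \<longleftrightarrow> (\<exists>ws \<in> chains_from W R w. length ws = Suc (Suc n))"
  proof
    assume "\<exists>ws \<in> chains_from W R w. length ws = Suc (Suc n)"
    then obtain ws where ws: "ws \<in> chains_from W R w" "length ws = Suc (Suc n)"
      by blast
    then have "ws = w # tl ws"
      by (auto simp: chains_from_def)
    then show "\<exists>ws. w # ws \<in> chains_from W R w \<and> length ws = Suc n"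
      using ws by (intro exI[of _ "tl ws"]) simp
  qed (auto intro: rev_bexI)
  finally show ?case .
qed

text \<open>
  An infinite supremum only provides chains of unbounded length; cutting a longer one down
  gives a chain of each exact length.
\<close>
lemma height_from_infinite_iff:
  "height_from W R w = \<infinity> \<longleftrightarrow> (\<forall>n. \<exists>ws \<in> chains_from W R w. length ws = Suc n)"
proof
  assume inf: "height_from W R w = \<infinity>"
  show "\<forall>n. \<exists>ws \<in> chains_from W R w. length ws = Suc n"
  proof
    fix n
    have "enat n < height_from W R w"
      by (simp add: inf)
    then obtain ws where ws: "ws \<in> chains_from W R w" "n < length ws"
      by (auto simp: height_from_def less_SUP_iff)
    then have "take (Suc n) ws \<in> chains_from W R w" "length (take (Suc n) ws) = Suc n"
      by (simp_all add: take_in_chains_from)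
    then show "\<exists>ws \<in> chains_from W R w. length ws = Suc n"
      by blast
  qed
next
  assume all: "\<forall>n. \<exists>ws \<in> chains_from W R w. length ws = Suc n"
  have lower: "enat (Suc n) \<le> height_from W R w" for n
  proof -
    obtain ws where "ws \<in> chains_from W R w" "length ws = Suc n"
      using all by blast
    then show ?thesis
      unfolding height_from_def by (intro SUP_upper2[of ws]) simp_all
  qed
  show "height_from W R w = \<infinity>"
  proof (cases "height_from W R w")
    case (enat m)
    then show ?thesis
      using lower[of m] by simp
  qed
qed

lemma height_from_infinite_iff_Dia_pow:
  "height_from W R w = \<infinity> \<longleftrightarrow> (\<forall>n. w \<in> ext W R v ((Dia ^^ n) Top))"
  by (simp add: height_from_infinite_iff mem_ext_Dia_pow_iff)

lemma diamond_star_strongly_valid_iff: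
  "scheme_strongly_valid W R (diamond_star :: 'p rule set) \<longleftrightarrow>
     (\<forall>(\<phi> :: 'p fm) v. valuation W v \<longrightarrow>
        \<not> (\<exists>w \<in> W. w \<in> ext W R v \<phi> \<and> (\<forall>n. w \<in> ext W R v ((Dia ^^ n) Top))))"
proof -
  have premises_hold: "W \<inter> (\<Inter>\<gamma> \<in> {Imp \<phi> ((Dia ^^ n) Top) | n. True}. ext W R v \<gamma>) \<subseteq> E \<longleftrightarrow>
        (\<forall>w \<in> W. (\<forall>n. w \<in> ext W R v (Imp \<phi> ((Dia ^^ n) Top))) \<longrightarrow> w \<in> E)"
    for \<phi> :: "'p fm" and v E
    by blast
  have "strongly_valid W R ({Imp \<phi> ((Dia ^^ n) Top) | n. True}, Imp \<phi> Bot) \<longleftrightarrow>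
        (\<forall>v. valuation W v \<longrightarrow>
           \<not> (\<exists>w \<in> W. w \<in> ext W R v \<phi> \<and> (\<forall>n. w \<in> ext W R v ((Dia ^^ n) Top))))"
    for \<phi> :: "'p fm"
    unfolding strongly_valid_def fst_conv snd_conv premises_hold by (auto simp: mem_ext_Imp)
  moreover have "scheme_strongly_valid W R (diamond_star :: 'p rule set) \<longleftrightarrow>
    (\<forall>\<phi> :: 'p fm. strongly_valid W R ({Imp \<phi> ((Dia ^^ n) Top) | n. True}, Imp \<phi> Bot))"
    unfolding scheme_strongly_valid_def diamond_star_def by blast
  ultimately show ?thesis
    by (simp only:)
qed

theorem theorem4p1:
  fixes W :: "'w set" and R :: "('w \<times> 'w) set"
  assumes "kripke_frame W R" and "trans R"
  shows "locally_finite_height W R \<longleftrightarrow>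
         scheme_strongly_valid W R (diamond_star :: ('p::countable) rule set)"
proof
  assume "locally_finite_height W R"
  then show "scheme_strongly_valid W R (diamond_star :: 'p rule set)"
    by (auto simp: locally_finite_height_def diamond_star_strongly_valid_iff
        simp flip: height_from_infinite_iff_Dia_pow)
next
  assume valid: "scheme_strongly_valid W R (diamond_star :: 'p rule set)"
  define v :: "'p \<Rightarrow> 'w set" where "v = (\<lambda>_. {})"
  have "valuation W v"
    by (simp add: valuation_def v_def)
  then have "\<not> (\<exists>w \<in> W. w \<in> ext W R v Top \<and> (\<forall>n. w \<in> ext W R v ((Dia ^^ n) Top)))"
    using valid unfolding diamond_star_strongly_valid_iff by blast
  then show "locally_finite_height W R"
    by (auto simp: locally_finite_height_def simp flip: height_from_infinite_iff_Dia_pow)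
qed

end
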